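(* Consider the semilinear system $\dot x(t)=Ax(t)+f(t,x(t),u(t))$, $x(t_0)=x_0$, on the Banach space $\mathcal X$, where $A$ generates a $C_0$-semigroup $T(\cdot)$ on $\mathcal X$ and $f:\mathbb R_{\ge0}\times\mathcal X\times\mathsf U\to\mathcal X$. Suppose that: (SL1) there exist a strictly increasing unbounded sequence of positive times $\{\tau_k\}_{k=1}^\infty$ and continuous functions $f_k:[\tau_k,\tau_{k+1}]\times\mathcal X\times\mathsf U\to\mathcal X$, $k=0,1,\dots$, with $\tau_0=0$, such that $f=f_k$ on $[\tau_k,\tau_{k+1})\times\mathcal X\times\mathsf U$; (SL2) for all $r>0$ there exists $L=L(r)\ge0$ such that $\|f(t,\xi,\mu)-f(t,\omega,\mu)\|_{\mathcal X}\le L\|\xi-\omega\|_{\mathcal X}$ for all $t\ge0$, all $\xi,\omega\in\mathcal X$ with norms $\le r$ and all $\mu\in\mathsf U$ with $\|\mu\|_{\mathsf U}\le r$; (SL3) there exist $\gamma\in\mathcal K_\infty$ and a non-decreasing $N:\mathbb R_{\ge0}\to\mathbb R_{>0}$ such that $\|f(t,\xi,\mu)\|_{\mathcal X}\le N(\|\xi\|_{\mathcal X})(1+\gamma(\|\mu\|_{\mathsf U}))$ for all $t\ge0$, $\xi\in\mathcal X$, $\mu\in\mathsf U$; (SL4) for every $r>0$ and $\varepsilon>0$ there exists $\delta>0$ such that for all $t\ge0$, $\|f(t,\xi,\mu)-f(t,\xi,0)\|_{\mathcal X}<\varepsilon$ if $\|\xi\|_{\mathcal X}\le r$ and $\|\mu\|_{\mathsf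 U}\le\delta$. Let $\gamma\in\mathcal K_\infty$ be the function from (SL3) and set $\|u\|_\gamma=\int_0^\infty\gamma(\|u(s)\|_{\mathsf U})\,ds$. Then for every $r>0$, $\varepsilon>0$ and $T_0>0$ there exists $\delta=\delta(r,\varepsilon,T_0)>0$ such that for every $t_0\ge0$, $x_0\in\mathcal X$ and $u\in\mathcal U$ with $\|u\|_\gamma\le\delta$: if $x(\cdot)$ and $z(\cdot)$ are the maximally defined weak solutions corresponding to initial time $t_0$, initial state $x_0$ and inputs $u$ and $\mathbf 0$, respectively, and if for some $t^*\in[t_0,t_0+T_0]$ both are defined on $[t_0,t^*]$ with $\|x(t)\|_{\mathcal X}\le r$ and $\|z(t)\|_{\mathcal X}\le r$ for all $t\in[t_0,t^*]$, then $\|z(t)-x(t)\|_{\mathcal X}\le\varepsilon$ for all $t\in[t_0,t^*]$.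
   Context: $\gamma\in\mathcal K_\infty$ means $\gamma:\mathbb R_{\ge0}\to\mathbb R_{\ge0}$ is continuous, strictly increasing, unbounded, $\gamma(0)=0$. $\mathcal X$ is a Banach space with norm $\|\cdot\|_{\mathcal X}$, $\mathsf U$ a normed space with norm $\|\cdot\|_{\mathsf U}$. The admissible inputs $\mathcal U$ are all piecewise continuous functions $u:\mathbb R_{\ge0}\to\mathsf U$ (finitely many discontinuities on each bounded interval, with one-sided limits there); $\mathbf 0$ is the zero input. A weak solution on $J=[t_0,\tau)$ or $[t_0,\tau]$ corresponding to $(t_0,x_0,u)$ is a continuous $x:J\to\mathcal X$ with $x(t)=T(t-t_0)x_0+\int_{t_0}^tT(t-s)f(s,x(s),u(s))\,ds$ for all $t\in J$ (Bochner integral). Under (SL1)--(SL3), for every $t_0\ge0$, $x_0\in\mathcal X$, $u\in\mathcal U$ there is a unique maximally defined weak solution $x:[t_0,t_{(t_0,x_0,u)})\to\mathcal X$. *)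

theory Defs
  imports "HOL-Analysis.Analysis"
begin

text \<open>Functions on the half-line \<open>[0,\<infinity>)\<close> are represented by functions on \<^typ>\<open>real\<close> of which
  only the values on \<^term>\<open>{0::real..}\<close> matter.\<close>

definition class_K_infinity :: "(real \<Rightarrow> real) \<Rightarrow> bool" where
  "class_K_infinity \<gamma> \<longleftrightarrow>
     continuous_on {0..} \<gamma> \<and> strict_mono_on {0..} \<gamma> \<and> \<not> bdd_above (\<gamma> ` {0..}) \<and> \<gamma> 0 = 0"

definition C0_semigroup :: "(real \<Rightarrow> 'x::banach \<Rightarrow>\<^sub>L 'x) \<Rightarrow> bool" where
  "C0_semigroup T \<longleftrightarrow>
     T 0 = id_blinfun \<and>
     (\<forall>s\<ge>0. \<forall>t\<ge>0. T (s + t) = T s o\<^sub>L T t) \<and>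
     (\<forall>x. ((\<lambda>t. T t x) \<longlongrightarrow> x) (at_right 0))"

text \<open>The generator is an unbounded operator; it is given by its domain \<open>D\<close> and a function \<open>A\<close> of
  which only the values on \<open>D\<close> matter.\<close>

definition generates_C0_semigroup ::
    "'x set \<Rightarrow> ('x \<Rightarrow> 'x) \<Rightarrow> (real \<Rightarrow> 'x::banach \<Rightarrow>\<^sub>L 'x) \<Rightarrow> bool" where
  "generates_C0_semigroup D A T \<longleftrightarrow>
     C0_semigroup T \<and>
     D = {x. \<exists>y. ((\<lambda>h. (T h x - x) /\<^sub>R h) \<longlongrightarrow> y) (at_right 0)} \<and>
     (\<forall>x\<in>D. ((\<lambda>h. (T h x - x) /\<^sub>R h) \<longlongrightarrow> A x) (at_right 0))"

text \<open>The Bochner integral of the library is restricted to second countable (hence separable)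
  spaces. In an arbitrary Banach space, Borel measurability has to be replaced by strong
  measurability, that is, by almost everywhere convergence of a sequence of simple functions.\<close>

definition has_strong_bochner_integral :: "'a measure \<Rightarrow> ('a \<Rightarrow> 'x::banach) \<Rightarrow> 'x \<Rightarrow> bool" where
  "has_strong_bochner_integral M g I \<longleftrightarrow>
     (\<exists>s. (\<forall>i. Bochner_Integration.simple_bochner_integrable M (s i)) \<and>
          (AE x in M. (\<lambda>i. s i x) \<longlonglongrightarrow> g x) \<and>
          (\<lambda>i. \<integral>\<^sup>+x. ennreal (norm (g x - s i x)) \<partial>M) \<longlonglongrightarrow> 0 \<and>
          (\<lambda>i. Bochner_Integration.simple_bochner_integral M (s i)) \<longlonglongrightarrow> I)"

definition admissible_input :: "(real \<Rightarrow> 'u::real_normed_vector) \<Rightarrow> bool" where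
  "admissible_input u \<longleftrightarrow>
     (\<forall>b. finite {t\<in>{0..b}. \<not> continuous (at t within {0..}) u}) \<and>
     (\<forall>t\<ge>0. \<not> continuous (at t within {0..}) u \<longrightarrow>
        (\<exists>l. (u \<longlongrightarrow> l) (at_right t)) \<and> (t > 0 \<longrightarrow> (\<exists>l. (u \<longlongrightarrow> l) (at_left t))))"

text \<open>The value is an extended real because the integral may be infinite.\<close>

definition gamma_norm :: "(real \<Rightarrow> real) \<Rightarrow> (real \<Rightarrow> 'u::real_normed_vector) \<Rightarrow> ennreal" where
  "gamma_norm \<gamma> u = (\<integral>\<^sup>+s\<in>{0..}. ennreal (\<gamma> (norm (u s))) \<partial>lborel)"

definition solution_interval :: "real \<Rightarrow> real set \<Rightarrow> bool" where
  "solution_interval t0 J \<longleftrightarrow>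
     (\<exists>\<tau>>ereal t0. J = {t. t0 \<le> t \<and> ereal t < \<tau>}) \<or> (\<exists>\<tau>>t0. J = {t0..\<tau>})"

definition weak_solution ::
    "(real \<Rightarrow> 'x::banach \<Rightarrow>\<^sub>L 'x) \<Rightarrow> (real \<Rightarrow> 'x \<Rightarrow> 'u::real_normed_vector \<Rightarrow> 'x) \<Rightarrow>
     real \<Rightarrow> 'x \<Rightarrow> (real \<Rightarrow> 'u) \<Rightarrow> real set \<Rightarrow> (real \<Rightarrow> 'x) \<Rightarrow> bool" where
  "weak_solution T f t0 x0 u J x \<longleftrightarrow>
     solution_interval t0 J \<and> continuous_on J x \<and>
     (\<forall>t\<in>J. \<exists>I. has_strong_bochner_integral (lebesgue_on {t0..t})
                  (\<lambda>s. T (t - s) (f s (x s) (u s))) I \<and>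
                x t = T (t - t0) x0 + I)"

definition maximal_weak_solution ::
    "(real \<Rightarrow> 'x::banach \<Rightarrow>\<^sub>L 'x) \<Rightarrow> (real \<Rightarrow> 'x \<Rightarrow> 'u::real_normed_vector \<Rightarrow> 'x) \<Rightarrow>
     real \<Rightarrow> 'x \<Rightarrow> (real \<Rightarrow> 'u) \<Rightarrow> ereal \<Rightarrow> (real \<Rightarrow> 'x) \<Rightarrow> bool" where
  "maximal_weak_solution T f t0 x0 u \<tau> x \<longleftrightarrow>
     ereal t0 < \<tau> \<and>
     weak_solution T f t0 x0 u {t. t0 \<le> t \<and> ereal t < \<tau>} x \<and>
     (\<forall>J y. weak_solution T f t0 x0 u J y \<and> {t. t0 \<le> t \<and> ereal t < \<tau>} \<subseteq> J \<and>
            (\<forall>t. t0 \<le> t \<and> ereal t < \<tau> \<longrightarrow> y t = x t)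
        \<longrightarrow> J = {t. t0 \<le> t \<and> ereal t < \<tau>})"

end

theory Submission imports Defs begin

text \<open>
  Write \<open>\<phi> t = \<parallel>x t - z t\<parallel>\<close>. Subtracting the two variation-of-constants formulas cancels the initial
  state, and \<open>T\<close> is bounded by some \<open>M\<close> on \<open>[0, T0]\<close>, so \<open>\<phi> t\<close> is at most \<open>M\<close> times the integral of
  \<open>\<parallel>f s (x s) (u s) - f s (z s) 0\<parallel>\<close> over \<open>[t0, t]\<close>. Inserting \<open>f s (x s) 0\<close> splits the integrand into a part
  bounded by \<open>L * \<phi> s\<close> through the Lipschitz condition and a part measuring the effect of the input.

  The input need not be small pointwise, only in the integral sense. The pointwise bound that serves
  nevertheless is \<open>\<parallel>f s \<xi> \<mu> - f s \<xi> 0\<parallel> \<le> e + K * \<gamma> \<parallel>\<mu>\<parallel>\<close> on the ball of radius \<open>r\<close>, with \<open>e\<close> arbitrarily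
  small (\<open>input_perturbation_bound\<close>): small \<open>\<mu>\<close> are covered by uniform continuity at \<open>\<mu> = 0\<close>, and for large
  \<open>\<mu>\<close> the growth bound is dominated by a multiple of \<open>\<gamma> \<parallel>\<mu>\<parallel>\<close>. Integrating yields
  \<open>\<phi> t \<le> M * (e * T0 + K * \<delta>) + M * L * \<integral> \<phi>\<close> with the integral taken over \<open>[t0, t]\<close>, and Gronwall's inequality
  gives \<open>\<phi> t \<le> M * (e * T0 + K * \<delta>) * exp (M * L * T0)\<close>. Choosing first \<open>e\<close> and then \<open>\<delta>\<close>, each using up
  half of \<open>\<epsilon>\<close>, finishes the proof; neither depends on \<open>t0\<close>, \<open>x0\<close> or \<open>u\<close>.

  Three standard facts carry this argument: local boundedness of a \<open>C\<^sub>0\<close>-semigroup, which rests on the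
  uniform boundedness principle (\<open>C0_semigroup_bounded\<close>); the norm estimate for the Bochner integral
  in an arbitrary Banach space (\<open>has_strong_bochner_integral_norm_bound\<close>); and Gronwall's inequality
  (\<open>gronwall\<close>).
\<close>

section \<open>Local boundedness of strongly continuous semigroups\<close>

text \<open>The Banach--Steinhaus theorem. The sets \<open>C n\<close> of points where the family is bounded by \<open>n\<close> are
  closed and cover the space, so by Baire's theorem one of them contains a ball; by linearity a
  bound on a ball around any centre is a bound on the operator norms.\<close>

lemma uniform_boundedness:
  fixes F :: "'i \<Rightarrow> 'x::banach \<Rightarrow>\<^sub>L 'y::real_normed_vector"
  assumes "\<And>x. \<exists>B. \<forall>i\<in>I. norm (F i x) \<le> B"
  shows "\<exists>B. \<forall>i\<in>I. norm (F i) \<le> B"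
proof -
  define C where "C n = {x. \<forall>i\<in>I. norm (F i x) \<le> real n}" for n :: nat
  have closed: "closed (C n)" for n
  proof -
    have "C n = (\<Inter>i\<in>I. {x. norm (F i x) \<le> real n})"
      by (auto simp: C_def)
    moreover have "closed {x. norm (F i x) \<le> real n}" for i
      by (intro closed_Collect_le continuous_intros)
    ultimately show ?thesis by auto
  qed
  have cover: "(\<Union>n. C n) = UNIV"
  proof safe
    fix x
    obtain B where "\<forall>i\<in>I. norm (F i x) \<le> B" using assms by blast
    moreover obtain n where "B \<le> real n" using real_arch_simple by blast
    ultimately have "x \<in> C n" unfolding C_def using order_trans by blast
    then show "x \<in> (\<Union>n. C n)" by blast
  qed simp
  have "\<exists>n. interior (C n) \<noteq> {}"
  proof (rule ccontr)
    assume "\<not> ?thesis"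
    then have "euclidean interior_of \<Union> (range C) = {}"
      using closed by (intro Baire_category_alt) (auto simp: completely_metrizable_space_euclidean)
    then show False using cover by simp
  qed
  then obtain n a where "a \<in> interior (C n)" by blast
  then obtain e where e: "e > 0" "cball a e \<subseteq> C n"
    by (auto simp: mem_interior_cball)
  have "norm (F i) \<le> 2 * real n / e" if i: "i \<in> I" for i
  proof (rule norm_blinfun_bound)
    fix x
    show "norm (F i x) \<le> 2 * real n / e * norm x"
    proof (cases "x = 0")
      case False
      define y where "y = (e / norm x) *\<^sub>R x"
      have ny: "norm y = e" using e False by (simp add: y_def)
      have "a + y \<in> C n" "a \<in> C n"
        using e ny by (auto intro!: subsetD[OF e(2)] simp: dist_norm)
      then have b: "norm (F i (a + y)) \<le> n" "norm (F i a) \<le> n"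
        using i by (auto simp: C_def)
      have "F i y = F i (a + y) - F i a" by (simp add: blinfun.add_right)
      then have "norm (F i y) \<le> norm (F i (a + y)) + norm (F i a)"
        by (metis norm_triangle_ineq4)
      then have "norm (F i y) \<le> 2 * real n" using b by linarith
      moreover have "norm (F i y) = e / norm x * norm (F i x)"
        using e by (simp add: y_def blinfun.scaleR_right)
      ultimately show ?thesis using e False by (simp add: field_simps)
    qed simp
  qed (use e in simp)
  then show ?thesis by blast
qed

text \<open>Otherwise there are times tending to \<open>0\<close> at which the operator norms tend to infinity, while
  along the same times every orbit converges and hence stays bounded; this contradicts uniform
  boundedness.\<close>

lemma C0_semigroup_bounded_near_zero:
  assumes "C0_semigroup T"
  shows "\<exists>\<eta>>0. \<exists>B. \<forall>t\<in>{0..\<eta>}. norm (T t) \<le> B"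
proof (rule ccontr)
  assume neg: "\<not> ?thesis"
  have "\<exists>t\<in>{0..inverse (real (Suc n))}. norm (T t) > real n" for n
  proof -
    have "inverse (real (Suc n)) > 0" by simp
    then show ?thesis using neg not_less by blast
  qed
  then obtain s where s: "\<And>n. s n \<in> {0..inverse (real (Suc n))}" "\<And>n. norm (T (s n)) > real n"
    by metis
  have s0: "s \<longlonglongrightarrow> 0"
    by (rule tendsto_sandwich[OF _ _ tendsto_const LIMSEQ_inverse_real_of_nat])
       (use s in auto)
  have "\<exists>B. \<forall>n\<in>UNIV. norm (T (s n) x) \<le> B" for x
  proof -
    have "T 0 x = x" using assms by (simp add: C0_semigroup_def)
    then have "continuous (at 0 within {0..}) (\<lambda>t. T t x)"
      using assms by (simp add: C0_semigroup_def continuous_within at_within_Ici_at_right)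
    then have "(\<lambda>n. T (s n) x) \<longlonglongrightarrow> T 0 x"
    proof (rule continuous_within_tendsto_compose'[OF _ _ s0])
      show "s n \<in> {0..}" for n using s(1)[of n] by simp
    qed
    then have "bounded (range (\<lambda>n. T (s n) x))" by (rule convergent_imp_bounded)
    then show ?thesis by (auto simp: bounded_iff)
  qed
  then obtain B where "\<And>n. norm (T (s n)) \<le> B"
    using uniform_boundedness[of UNIV "\<lambda>n. T (s n)"] by auto
  moreover obtain n where "B \<le> real n" using real_arch_simple by blast
  ultimately show False using s(2)[of n] by (meson linorder_not_less order_trans)
qed

text \<open>By the semigroup law, a bound \<open>C \<ge> 1\<close> on \<open>[0, \<eta>]\<close> gives the bound \<open>C ^ Suc n\<close> on \<open>[0, n * \<eta>]\<close>.\<close>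

lemma C0_semigroup_bounded:
  assumes "C0_semigroup T"
  obtains B where "B > 0" "\<And>t. t \<in> {0..b} \<Longrightarrow> norm (T t) \<le> B"
proof -
  obtain \<eta> C0 where \<eta>: "\<eta> > 0" and C0: "\<And>t. t \<in> {0..\<eta>} \<Longrightarrow> norm (T t) \<le> C0"
    using C0_semigroup_bounded_near_zero[OF assms] by blast
  define C where "C = max 1 C0"
  have C: "C \<ge> 1" "\<And>t. t \<in> {0..\<eta>} \<Longrightarrow> norm (T t) \<le> C"
    using C0 by (force simp: C_def)+
  have *: "norm (T t) \<le> C ^ Suc n" if "t \<in> {0..real n * \<eta>}" for n t
    using that
  proof (induction n arbitrary: t)
    case 0
    then show ?case using C(2)[of 0] \<eta> by simp
  next
    case (Suc n)
    show ?case
    proof (cases "t \<le> \<eta>")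
      case True
      have "norm (T t) \<le> C" using C Suc True by simp
      also have "\<dots> \<le> C ^ Suc (Suc n)" using power_increasing[of 1 "Suc (Suc n)" C] C by simp
      finally show ?thesis .
    next
      case False
      have "T (\<eta> + (t - \<eta>)) = T \<eta> o\<^sub>L T (t - \<eta>)"
        using assms \<eta> False unfolding C0_semigroup_def by (meson diff_ge_0_iff_ge less_imp_le not_le)
      then have "norm (T t) \<le> norm (T \<eta>) * norm (T (t - \<eta>))"
        by (simp add: norm_blinfun_compose)
      also have "\<dots> \<le> C * C ^ Suc n"
        using Suc False \<eta> C by (intro mult_mono) (auto simp: algebra_simps)
      finally show ?thesis by simp
    qed
  qed
  obtain n where n: "b \<le> real n * \<eta>"
    using ex_less_of_nat_mult[OF \<eta>] by (meson less_imp_le)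
  show thesis
  proof
    show "C ^ Suc n > 0" using C by simp
    show "norm (T t) \<le> C ^ Suc n" if "t \<in> {0..b}" for t
      using that n * by simp
  qed
qed

section \<open>Estimates for the strong Bochner integral\<close>

text \<open>The norms \<open>norm (g x - s i x)\<close> need not be measurable when the measure is not complete, and the
  nonnegative integral is additive only for measurable functions. Almost everywhere, however, they
  are limits of the norms of the simple functions \<open>s j - s i\<close>.\<close>

lemma strong_bochner_error_measurable:
  fixes g :: "'a \<Rightarrow> 'x::banach"
  assumes s: "\<And>i. Bochner_Integration.simple_bochner_integrable M (s i)"
    and lim: "AE x in M. (\<lambda>i. s i x) \<longlonglongrightarrow> g x"
  obtains e where "e \<in> borel_measurable M" "AE x in M. ennreal (norm (g x - s i x)) = e x"
proof
  have sf: "simple_function M (s j)" for j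
    using s[of j] by (simp add: Bochner_Integration.simple_bochner_integrable.simps)
  show "(\<lambda>x. liminf (\<lambda>j. ennreal (norm (s j x - s i x)))) \<in> borel_measurable M"
    by (intro borel_measurable_liminf borel_measurable_simple_function
        simple_function_compose2[OF sf sf])
  show "AE x in M. ennreal (norm (g x - s i x)) = liminf (\<lambda>j. ennreal (norm (s j x - s i x)))"
    using lim
  proof eventually_elim
    case (elim x)
    then have "(\<lambda>j. ennreal (norm (s j x - s i x))) \<longlonglongrightarrow> ennreal (norm (g x - s i x))"
      by (intro tendsto_intros)
    then show ?case by (metis lim_imp_Liminf trivial_limit_sequentially)
  qed
qed

lemma has_strong_bochner_integral_diff:
  assumes "has_strong_bochner_integral M g I" "has_strong_bochner_integral M h J"
  shows "has_strong_bochner_integral M (\<lambda>x. g x - h x) (I - J)"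
proof -
  obtain s where s: "\<And>i. Bochner_Integration.simple_bochner_integrable M (s i)"
     "AE x in M. (\<lambda>i. s i x) \<longlonglongrightarrow> g x"
     "(\<lambda>i. \<integral>\<^sup>+x. ennreal (norm (g x - s i x)) \<partial>M) \<longlonglongrightarrow> 0"
     "(\<lambda>i. Bochner_Integration.simple_bochner_integral M (s i)) \<longlonglongrightarrow> I"
    using assms(1) unfolding has_strong_bochner_integral_def by blast
  obtain r where r: "\<And>i. Bochner_Integration.simple_bochner_integrable M (r i)"
     "AE x in M. (\<lambda>i. r i x) \<longlonglongrightarrow> h x"
     "(\<lambda>i. \<integral>\<^sup>+x. ennreal (norm (h x - r i x)) \<partial>M) \<longlonglongrightarrow> 0"
     "(\<lambda>i. Bochner_Integration.simple_bochner_integral M (r i)) \<longlonglongrightarrow> J"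
    using assms(2) unfolding has_strong_bochner_integral_def by blast
  have bound: "(\<integral>\<^sup>+x. ennreal (norm (g x - h x - (s i x - r i x))) \<partial>M)
      \<le> (\<integral>\<^sup>+x. ennreal (norm (g x - s i x)) \<partial>M) + (\<integral>\<^sup>+x. ennreal (norm (h x - r i x)) \<partial>M)" for i
  proof -
    obtain e where e: "e \<in> borel_measurable M" "AE x in M. ennreal (norm (g x - s i x)) = e x"
      using strong_bochner_error_measurable[OF s(1,2)] by blast
    obtain d where d: "d \<in> borel_measurable M" "AE x in M. ennreal (norm (h x - r i x)) = d x"
      using strong_bochner_error_measurable[OF r(1,2)] by blast
    have "(\<integral>\<^sup>+x. ennreal (norm (g x - h x - (s i x - r i x))) \<partial>M) \<le> (\<integral>\<^sup>+x. e x + d x \<partial>M)"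
    proof (rule nn_integral_mono_AE)
      show "AE x in M. ennreal (norm (g x - h x - (s i x - r i x))) \<le> e x + d x"
        using e(2) d(2)
      proof eventually_elim
        case (elim x)
        have "norm (g x - h x - (s i x - r i x)) \<le> norm (g x - s i x) + norm (h x - r i x)"
          using norm_triangle_ineq4[of "g x - s i x" "h x - r i x"] by (simp add: algebra_simps)
        then show ?case
          unfolding elim[symmetric] by (simp add: ennreal_leI flip: ennreal_plus)
      qed
    qed
    also have "\<dots> = (\<integral>\<^sup>+x. e x \<partial>M) + (\<integral>\<^sup>+x. d x \<partial>M)"
      using e d by (intro nn_integral_add)
    finally show ?thesis using nn_integral_cong_AE[OF e(2)] nn_integral_cong_AE[OF d(2)] by simp
  qed
  have err: "(\<lambda>i. \<integral>\<^sup>+x. ennreal (norm (g x - h x - (s i x - r i x))) \<partial>M) \<longlonglongrightarrow> 0"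
  proof (rule tendsto_sandwich[OF _ _ tendsto_const])
    show "(\<lambda>i. (\<integral>\<^sup>+x. ennreal (norm (g x - s i x)) \<partial>M) + (\<integral>\<^sup>+x. ennreal (norm (h x - r i x)) \<partial>M)) \<longlonglongrightarrow> 0"
      using tendsto_add[OF s(3) r(3)] by simp
  qed (use bound in auto)
  show ?thesis
    unfolding has_strong_bochner_integral_def
  proof (intro exI[of _ "\<lambda>i x. s i x - r i x"] conjI allI)
    show "Bochner_Integration.simple_bochner_integrable M (\<lambda>x. s i x - r i x)" for i
      by (rule Bochner_Integration.simple_bochner_integrable_compose2[OF _ s(1) r(1)]) simp
    show "AE x in M. (\<lambda>i. s i x - r i x) \<longlonglongrightarrow> g x - h x"
      using s(2) r(2) by eventually_elim (rule tendsto_diff)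
    show "(\<lambda>i. Bochner_Integration.simple_bochner_integral M (\<lambda>x. s i x - r i x)) \<longlonglongrightarrow> I - J"
      using tendsto_diff[OF s(4) r(4)] s(1) r(1)
      by (simp add: Bochner_Integration.simple_bochner_integral_diff)
  qed (rule err)
qed

text \<open>Pass to the limit in \<open>\<parallel>\<integral> s i\<parallel> \<le> \<integral> \<parallel>s i\<parallel> \<le> \<integral> h + \<integral> \<parallel>g - s i\<parallel>\<close>. The majorant \<open>h\<close> stands in for \<open>\<parallel>g\<parallel>\<close>
  so that the right-hand side is the integral of a measurable function.\<close>

lemma has_strong_bochner_integral_norm_bound:
  assumes "has_strong_bochner_integral M g I"
    and h: "h \<in> borel_measurable M" and le: "\<And>x. x \<in> space M \<Longrightarrow> ennreal (norm (g x)) \<le> h x"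
  shows "ennreal (norm I) \<le> (\<integral>\<^sup>+x. h x \<partial>M)"
proof -
  obtain s where s: "\<And>i. Bochner_Integration.simple_bochner_integrable M (s i)"
     "AE x in M. (\<lambda>i. s i x) \<longlonglongrightarrow> g x"
     "(\<lambda>i. \<integral>\<^sup>+x. ennreal (norm (g x - s i x)) \<partial>M) \<longlonglongrightarrow> 0"
     "(\<lambda>i. Bochner_Integration.simple_bochner_integral M (s i)) \<longlonglongrightarrow> I"
    using assms(1) unfolding has_strong_bochner_integral_def by blast
  have bound: "ennreal (norm (Bochner_Integration.simple_bochner_integral M (s i)))
      \<le> (\<integral>\<^sup>+x. h x \<partial>M) + (\<integral>\<^sup>+x. ennreal (norm (g x - s i x)) \<partial>M)" for i
  proof -
    obtain e where e: "e \<in> borel_measurable M" "AE x in M. ennreal (norm (g x - s i x)) = e x"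
      using strong_bochner_error_measurable[OF s(1,2)] by blast
    have "ennreal (norm (Bochner_Integration.simple_bochner_integral M (s i)))
        \<le> ennreal (Bochner_Integration.simple_bochner_integral M (\<lambda>x. norm (s i x)))"
      by (intro ennreal_leI Bochner_Integration.simple_bochner_integral_norm_bound s)
    also have "\<dots> = (\<integral>\<^sup>+x. norm (s i x) \<partial>M)"
      using s(1)[of i] by (intro Bochner_Integration.simple_bochner_integral_eq_nn_integral
        Bochner_Integration.simple_bochner_integrable_compose2[where p = "\<lambda>a b. norm a"]) auto
    also have "\<dots> \<le> (\<integral>\<^sup>+x. h x + e x \<partial>M)"
    proof (rule nn_integral_mono_AE)
      show "AE x in M. ennreal (norm (s i x)) \<le> h x + e x"
        using e(2) AE_space
      proof eventually_elim
        case (elim x)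
        have "norm (s i x) \<le> norm (g x) + norm (g x - s i x)"
          using norm_triangle_ineq4[of "g x" "g x - s i x"] by simp
        then have "ennreal (norm (s i x)) \<le> ennreal (norm (g x)) + ennreal (norm (g x - s i x))"
          by (simp add: ennreal_leI flip: ennreal_plus)
        also have "\<dots> \<le> h x + e x"
          using elim le by (intro add_mono) auto
        finally show ?case .
      qed
    qed
    also have "\<dots> = (\<integral>\<^sup>+x. h x \<partial>M) + (\<integral>\<^sup>+x. e x \<partial>M)"
      using e h by (intro nn_integral_add)
    finally show ?thesis using nn_integral_cong_AE[OF e(2)] by simp
  qed
  have "(\<lambda>i. (\<integral>\<^sup>+x. h x \<partial>M) + (\<integral>\<^sup>+x. ennreal (norm (g x - s i x)) \<partial>M)) \<longlonglongrightarrow> (\<integral>\<^sup>+x. h x \<partial>M)"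
    using tendsto_add[OF tendsto_const s(3), of "\<integral>\<^sup>+x. h x \<partial>M"] by simp
  moreover have "(\<lambda>i. ennreal (norm (Bochner_Integration.simple_bochner_integral M (s i)))) \<longlonglongrightarrow> ennreal (norm I)"
    using s(4) by (intro tendsto_intros)
  ultimately show ?thesis
    using bound by (blast intro: LIMSEQ_le)
qed

section \<open>Gronwall's inequality\<close>

text \<open>The right-hand side of the integral inequality, multiplied by \<open>exp (- \<beta> * (s - a))\<close>, is a
  nonincreasing function of \<open>s\<close>.\<close>

lemma gronwall:
  fixes \<phi> :: "real \<Rightarrow> real"
  assumes cont: "continuous_on {a..b} \<phi>" and \<beta>: "\<beta> \<ge> 0"
    and le: "\<And>t. t \<in> {a..b} \<Longrightarrow> \<phi> t \<le> \<alpha> + \<beta> * integral {a..t} \<phi>"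
    and t: "t \<in> {a..b}"
  shows "\<phi> t \<le> \<alpha> * exp (\<beta> * (t - a))"
proof -
  define G where "G s = (\<alpha> + \<beta> * integral {a..s} \<phi>) * exp (- \<beta> * (s - a))" for s
  have "G t \<le> G a"
  proof (rule DERIV_nonpos_imp_decreasing_open[of a t G])
    have ig: "\<phi> integrable_on {a..b}" by (rule integrable_continuous_interval[OF cont])
    show "continuous_on {a..t} G"
      unfolding G_def using t
      by (intro continuous_intros indefinite_integral_continuous_1 integrable_subinterval_real[OF ig]) auto
    fix s assume s: "a < s" "s < t"
    have "((\<lambda>s. integral {a..s} \<phi>) has_real_derivative \<phi> s) (at s)"
      using integral_has_real_derivative[OF cont, of s] s t
      by (simp add: at_within_Icc_at)
    then have "(G has_real_derivative
        (\<beta> * \<phi> s - \<beta> * (\<alpha> + \<beta> * integral {a..s} \<phi>)) * exp (- \<beta> * (s - a))) (at s)"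
      unfolding G_def by (auto intro!: derivative_eq_intros simp: algebra_simps)
    moreover have "\<beta> * \<phi> s \<le> \<beta> * (\<alpha> + \<beta> * integral {a..s} \<phi>)"
      using le[of s] s t \<beta> by (intro mult_left_mono) auto
    ultimately show "\<exists>y. (G has_real_derivative y) (at s) \<and> y \<le> 0"
      by (force intro: mult_nonpos_nonneg)
  qed (use t in auto)
  then have "G t \<le> \<alpha>" by (simp add: G_def)
  then have "G t * exp (\<beta> * (t - a)) \<le> \<alpha> * exp (\<beta> * (t - a))"
    by simp
  moreover have "G t * exp (\<beta> * (t - a)) = \<alpha> + \<beta> * integral {a..t} \<phi>"
    by (simp add: G_def mult.assoc flip: exp_add)
  ultimately have "\<alpha> + \<beta> * integral {a..t} \<phi> \<le> \<alpha> * exp (\<beta> * (t - a))"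
    by simp
  with le[OF t] show ?thesis by linarith
qed

section \<open>Inputs and their effect on the nonlinearity\<close>

lemma class_K_infinity_pos:
  assumes "class_K_infinity \<gamma>" "s > 0"
  shows "\<gamma> s > 0"
  using assms strict_mono_onD[of "{0..}" \<gamma> 0 s] by (auto simp: class_K_infinity_def)

lemma class_K_infinity_mono:
  assumes "class_K_infinity \<gamma>" "0 \<le> s" "s \<le> t"
  shows "\<gamma> s \<le> \<gamma> t"
  using assms by (auto simp: class_K_infinity_def dest!: strict_mono_on_imp_mono_on intro: mono_onD)

lemma class_K_infinity_nonneg:
  assumes "class_K_infinity \<gamma>" "s \<ge> 0"
  shows "\<gamma> s \<ge> 0"
  using class_K_infinity_mono[OF assms(1), of 0 s] assms by (simp add: class_K_infinity_def)

text \<open>On a bounded interval the function is continuous apart from finitely many points, and changing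
  a function at finitely many points preserves Borel measurability.\<close>

lemma admissible_input_measurable:
  fixes u :: "real \<Rightarrow> 'u::real_normed_vector"
  assumes "admissible_input u" "class_K_infinity \<gamma>" "a \<ge> 0"
  shows "(\<lambda>s. indicator {a..b} s * \<gamma> (norm (u s))) \<in> borel_measurable borel"
proof -
  define E where "E = {t\<in>{0..b}. \<not> continuous (at t within {0..}) u}"
  have E: "finite E" using assms(1) by (simp add: admissible_input_def E_def)
  have "continuous_on ({a..b} - E) u"
    unfolding continuous_on_eq_continuous_within
  proof
    fix t assume "t \<in> {a..b} - E"
    then have "continuous (at t within {0..}) u" using assms(3) by (auto simp: E_def)
    then show "continuous (at t within {a..b} - E) u"
      using assms(3) by (auto elim!: continuous_within_subset)
  qed
  then have "continuous_on ({a..b} - E) (\<lambda>s. \<gamma> (norm (u s)))"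
    using assms(2) unfolding class_K_infinity_def
    by (auto intro: continuous_on_compose2[of "{0..}" \<gamma> _ "\<lambda>s. norm (u s)"] continuous_on_norm)
  then have "(\<lambda>s. indicator ({a..b} - E) s *\<^sub>R \<gamma> (norm (u s))) \<in> borel_measurable borel"
    using E by (intro borel_measurable_continuous_on_indicator sets.Diff) (simp_all add: finite_imp_closed borel_closed)
  then show ?thesis
    by (rule measurable_discrete_difference[where X = E])
      (use E in \<open>auto simp: indicator_def intro: countable_finite\<close>)
qed

text \<open>The key pointwise estimate, which turns a bound on the integral of \<open>\<gamma> \<parallel>u\<parallel>\<close> into a bound on the
  accumulated perturbation. If \<open>\<parallel>\<mu>\<parallel>\<close> is below the threshold \<open>d\<close> belonging to \<open>\<epsilon>\<close>, the term \<open>\<epsilon>\<close> suffices. If it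
  is above, the growth bound gives \<open>N r * (2 + \<gamma> \<parallel>\<mu>\<parallel>)\<close>, and there the constant \<open>2\<close> is at most
  \<open>(2 / \<gamma> d) * \<gamma> \<parallel>\<mu>\<parallel>\<close> because \<open>\<gamma>\<close> is increasing.\<close>

lemma input_perturbation_bound:
  fixes f :: "real \<Rightarrow> 'x::real_normed_vector \<Rightarrow> 'u::real_normed_vector \<Rightarrow> 'y::real_normed_vector"
  assumes gamma: "class_K_infinity \<gamma>"
    and N: "mono_on {0..} N" "\<forall>s\<ge>0. N s > 0"
    and growth: "\<forall>t\<ge>0. \<forall>\<xi> \<mu>. norm (f t \<xi> \<mu>) \<le> N (norm \<xi>) * (1 + \<gamma> (norm \<mu>))"
    and small: "\<forall>r>0. \<forall>\<epsilon>>0. \<exists>\<delta>>0. \<forall>t\<ge>0. \<forall>\<xi> \<mu>.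
        norm \<xi> \<le> r \<longrightarrow> norm \<mu> \<le> \<delta> \<longrightarrow> norm (f t \<xi> \<mu> - f t \<xi> 0) < \<epsilon>"
    and "r > 0" "\<epsilon> > 0"
  obtains K where "K > 0"
    "\<And>t \<xi> \<mu>. t \<ge> 0 \<Longrightarrow> norm \<xi> \<le> r \<Longrightarrow>
       norm (f t \<xi> \<mu> - f t \<xi> 0) \<le> \<epsilon> + K * \<gamma> (norm \<mu>)"
proof -
  obtain d where d: "d > 0" "\<And>t \<xi> \<mu>. t \<ge> 0 \<Longrightarrow> norm \<xi> \<le> r \<Longrightarrow> norm \<mu> \<le> d \<Longrightarrow>
      norm (f t \<xi> \<mu> - f t \<xi> 0) < \<epsilon>"
    using small \<open>r > 0\<close> \<open>\<epsilon> > 0\<close> by meson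
  have \<gamma>d: "\<gamma> d > 0" using class_K_infinity_pos[OF gamma d(1)] .
  define K where "K = N r * (2 / \<gamma> d + 1)"
  have Nr: "N r > 0" using N \<open>r > 0\<close> by auto
  have K: "K > 0" using Nr \<gamma>d by (auto simp: K_def intro!: mult_pos_pos add_pos_pos)
  have "norm (f t \<xi> \<mu> - f t \<xi> 0) \<le> \<epsilon> + K * \<gamma> (norm \<mu>)"
    if t: "t \<ge> 0" and \<xi>: "norm \<xi> \<le> r" for t \<xi> \<mu>
  proof (cases "norm \<mu> \<le> d")
    case True
    have "0 \<le> K * \<gamma> (norm \<mu>)"
      using K class_K_infinity_nonneg[OF gamma] by simp
    then show ?thesis using d(2)[OF t \<xi> True] by linarith
  next
    case False
    have N\<xi>: "N (norm \<xi>) \<le> N r" using \<xi> \<open>r > 0\<close> by (intro mono_onD[OF N(1)]) auto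
    have \<gamma>0: "\<gamma> 0 = 0" using gamma by (simp add: class_K_infinity_def)
    have *: "norm (f t \<xi> \<nu>) \<le> N r * (1 + \<gamma> (norm \<nu>))" for \<nu>
    proof -
      have "norm (f t \<xi> \<nu>) \<le> N (norm \<xi>) * (1 + \<gamma> (norm \<nu>))" using growth t by blast
      also have "\<dots> \<le> N r * (1 + \<gamma> (norm \<nu>))"
        using N\<xi> class_K_infinity_nonneg[OF gamma, of "norm \<nu>"] by (intro mult_right_mono) auto
      finally show ?thesis .
    qed
    have "norm (f t \<xi> \<mu> - f t \<xi> 0) \<le> norm (f t \<xi> \<mu>) + norm (f t \<xi> 0)"
      by (rule norm_triangle_ineq4)
    also have "\<dots> \<le> N r * (2 + \<gamma> (norm \<mu>))"
      using *[of \<mu>] *[of 0] \<gamma>0 by (simp add: algebra_simps)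
    also have "\<dots> \<le> N r * (2 / \<gamma> d * \<gamma> (norm \<mu>) + \<gamma> (norm \<mu>))"
    proof -
      have "\<gamma> d \<le> \<gamma> (norm \<mu>)" using class_K_infinity_mono[OF gamma, of d "norm \<mu>"] d False by simp
      then have "2 \<le> 2 / \<gamma> d * \<gamma> (norm \<mu>)" using \<gamma>d by (simp add: field_simps)
      then show ?thesis using Nr by simp
    qed
    also have "\<dots> = K * \<gamma> (norm \<mu>)" by (simp add: K_def algebra_simps)
    finally show ?thesis using \<open>\<epsilon> > 0\<close> by linarith
  qed
  with K that show thesis by blast
qed

section \<open>Comparison of weak solutions\<close>

text \<open>Two weak solutions with the same initial state and different inputs: the terms \<open>T (t - t0) x0\<close>
  cancel, so only the Bochner integrals are compared. The majorant is split as \<open>g + k\<close> because its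
  two parts are integrated differently: \<open>g\<close> is continuous and will carry the difference of the
  solutions, whereas \<open>k\<close> is merely measurable and is controlled by its total integral alone.\<close>

lemma weak_solution_difference_bound:
  assumes x: "weak_solution T f t0 x0 u J x" "{t0..t} \<subseteq> J"
    and z: "weak_solution T f t0 x0 v J' z" "{t0..t} \<subseteq> J'"
    and "t0 \<le> t"
    and M: "\<And>s. s \<in> {0..t - t0} \<Longrightarrow> norm (T s) \<le> M"
    and le: "\<And>s. s \<in> {t0..t} \<Longrightarrow> norm (f s (x s) (u s) - f s (z s) (v s)) \<le> g s + k s"
    and g: "continuous_on {t0..t} g" "\<And>s. s \<in> {t0..t} \<Longrightarrow> g s \<ge> 0"
    and k: "(\<lambda>s. indicator {t0..t} s * k s) \<in> borel_measurable borel"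
      "\<And>s. s \<in> {t0..t} \<Longrightarrow> k s \<ge> 0"
      "(\<integral>\<^sup>+s\<in>{t0..t}. ennreal (k s) \<partial>lborel) \<le> ennreal \<delta>" "\<delta> \<ge> 0"
  shows "norm (x t - z t) \<le> M * (integral {t0..t} g + \<delta>)"
proof -
  let ?A = "{t0..t}"
  have M0: "M \<ge> 0" using M[of 0] \<open>t0 \<le> t\<close> order_trans[OF norm_ge_zero] by auto
  obtain I where I: "has_strong_bochner_integral (lebesgue_on ?A) (\<lambda>s. T (t - s) (f s (x s) (u s))) I"
      "x t = T (t - t0) x0 + I"
    using x \<open>t0 \<le> t\<close> unfolding weak_solution_def by force
  obtain I' where I': "has_strong_bochner_integral (lebesgue_on ?A) (\<lambda>s. T (t - s) (f s (z s) (v s))) I'"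
      "z t = T (t - t0) x0 + I'"
    using z \<open>t0 \<le> t\<close> unfolding weak_solution_def by force
  \<comment> \<open>The cut-off to the interval of integration makes the majorant Borel measurable on the whole line.\<close>
  define h where "h s = ennreal M * (ennreal (indicator ?A s * g s) + ennreal (indicator ?A s * k s))" for s
  have mg [measurable]: "(\<lambda>s. indicator ?A s * g s) \<in> borel_measurable borel"
    using borel_measurable_continuous_on_indicator[OF _ g(1)] by simp
  note k(1) [measurable]
  have h [measurable]: "h \<in> borel_measurable borel"
    unfolding h_def by measurable
  have "h \<in> borel_measurable lebesgue"
    by (rule measurable_completion) simp
  then have "h \<in> borel_measurable (lebesgue_on ?A)"
    by (rule measurable_restrict_space1)
  moreover have "ennreal (norm (T (t - s) (f s (x s) (u s)) - T (t - s) (f s (z s) (v s)))) \<le> h s"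
    if "s \<in> space (lebesgue_on ?A)" for s
  proof -
    have s: "s \<in> ?A" using that by simp
    have "norm (T (t - s) (f s (x s) (u s)) - T (t - s) (f s (z s) (v s)))
        \<le> norm (T (t - s)) * norm (f s (x s) (u s) - f s (z s) (v s))"
      by (metis blinfun.diff_right norm_blinfun)
    also have "\<dots> \<le> M * (g s + k s)"
      using M[of "t - s"] s le[OF s] M0 by (intro mult_mono) auto
    finally show ?thesis
      using s g(2)[OF s] k(2)[OF s] M0 by (simp add: h_def ennreal_leI flip: ennreal_plus ennreal_mult)
  qed
  ultimately have "ennreal (norm (I - I')) \<le> (\<integral>\<^sup>+s. h s \<partial>lebesgue_on ?A)"
    by (intro has_strong_bochner_integral_norm_bound[OF has_strong_bochner_integral_diff[OF I(1) I'(1)]])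
  also have "\<dots> = (\<integral>\<^sup>+s. h s * indicator ?A s \<partial>lborel)"
    by (simp add: nn_integral_restrict_space nn_integral_completion)
  also have "\<dots> = (\<integral>\<^sup>+s. h s \<partial>lborel)"
    by (intro nn_integral_cong) (auto simp: h_def indicator_def)
  also have "\<dots> = ennreal M * ((\<integral>\<^sup>+s. ennreal (indicator ?A s * g s) \<partial>lborel)
      + (\<integral>\<^sup>+s. ennreal (indicator ?A s * k s) \<partial>lborel))"
    unfolding h_def by (simp add: nn_integral_cmult nn_integral_add)
  also have "(\<integral>\<^sup>+s. ennreal (indicator ?A s * g s) \<partial>lborel) = ennreal (integral ?A g)"
    using g by (intro nn_integral_has_integral_lebesgue integrable_integral integrable_continuous_interval)
  also have "(\<integral>\<^sup>+s. ennreal (indicator ?A s * k s) \<partial>lborel) = (\<integral>\<^sup>+s\<in>?A. ennreal (k s) \<partial>lborel)"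
    by (intro nn_integral_cong) (auto simp: indicator_def)
  also have "ennreal M * (ennreal (integral ?A g) + (\<integral>\<^sup>+s\<in>?A. ennreal (k s) \<partial>lborel))
      \<le> ennreal M * (ennreal (integral ?A g) + ennreal \<delta>)"
    using k(3) by (intro mult_left_mono add_left_mono) auto
  also have ig: "integral ?A g \<ge> 0"
    using g by (intro integral_nonneg integrable_continuous_interval) auto
  then have "ennreal M * (ennreal (integral ?A g) + ennreal \<delta>) = ennreal (M * (integral ?A g + \<delta>))"
    using M0 k(4) by (simp flip: ennreal_plus ennreal_mult)
  finally have "norm (I - I') \<le> M * (integral ?A g + \<delta>)"
    using M0 k(4) ig by (simp add: ennreal_le_iff)
  then show ?thesis using I(2) I'(2) by simp
qed

theorem lemma5p3:
  fixes D :: "'x::banach set" and A :: "'x \<Rightarrow> 'x" and T :: "real \<Rightarrow> 'x \<Rightarrow>\<^sub>L 'x"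
    and f :: "real \<Rightarrow> 'x \<Rightarrow> 'u::real_normed_vector \<Rightarrow> 'x"
    and \<gamma> N :: "real \<Rightarrow> real"
  assumes generator: "generates_C0_semigroup D A T"
    and SL1: "\<exists>(\<tau> :: nat \<Rightarrow> real) (F :: nat \<Rightarrow> real \<Rightarrow> 'x \<Rightarrow> 'u \<Rightarrow> 'x).
        \<tau> 0 = 0 \<and> strict_mono \<tau> \<and> \<not> bdd_above (range \<tau>) \<and>
        (\<forall>k. continuous_on ({\<tau> k..\<tau> (Suc k)} \<times> UNIV \<times> UNIV) (\<lambda>(t, \<xi>, \<mu>). F k t \<xi> \<mu>) \<and>
             (\<forall>t\<in>{\<tau> k..<\<tau> (Suc k)}. \<forall>\<xi> \<mu>. f t \<xi> \<mu> = F k t \<xi> \<mu>))"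
    and SL2: "\<forall>r>0. \<exists>L\<ge>0. \<forall>t\<ge>0. \<forall>\<xi> \<omega> \<mu>.
        norm \<xi> \<le> r \<longrightarrow> norm \<omega> \<le> r \<longrightarrow> norm \<mu> \<le> r \<longrightarrow>
        norm (f t \<xi> \<mu> - f t \<omega> \<mu>) \<le> L * norm (\<xi> - \<omega>)"
    and gamma: "class_K_infinity \<gamma>"
    and N: "mono_on {0..} N" "\<forall>s\<ge>0. N s > 0"
    and SL3: "\<forall>t\<ge>0. \<forall>\<xi> \<mu>. norm (f t \<xi> \<mu>) \<le> N (norm \<xi>) * (1 + \<gamma> (norm \<mu>))"
    and SL4: "\<forall>r>0. \<forall>\<epsilon>>0. \<exists>\<delta>>0. \<forall>t\<ge>0. \<forall>\<xi> \<mu>.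
        norm \<xi> \<le> r \<longrightarrow> norm \<mu> \<le> \<delta> \<longrightarrow> norm (f t \<xi> \<mu> - f t \<xi> 0) < \<epsilon>"
  shows "\<forall>r>0. \<forall>\<epsilon>>0. \<forall>T0>0. \<exists>\<delta>>0. \<forall>t0\<ge>0. \<forall>x0 u.
      admissible_input u \<longrightarrow> gamma_norm \<gamma> u \<le> ennreal \<delta> \<longrightarrow>
      (\<forall>\<tau>x x \<tau>z z.
         maximal_weak_solution T f t0 x0 u \<tau>x x \<longrightarrow>
         maximal_weak_solution T f t0 x0 (\<lambda>_. 0) \<tau>z z \<longrightarrow>
         (\<forall>t'\<in>{t0..t0 + T0}.
            ereal t' < \<tau>x \<longrightarrow> ereal t' < \<tau>z \<longrightarrow>
            (\<forall>t\<in>{t0..t'}. norm (x t) \<le> r \<and> norm (z t) \<le> r) \<longrightarrow>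
            (\<forall>t\<in>{t0..t'}. norm (z t - x t) \<le> \<epsilon>)))"
proof (intro allI impI)
  fix r \<epsilon> T0 :: real
  assume "r > 0" "\<epsilon> > 0" "T0 > 0"
  obtain M where M: "M > 0" "\<And>t. t \<in> {0..T0} \<Longrightarrow> norm (T t) \<le> M"
    using C0_semigroup_bounded generator unfolding generates_C0_semigroup_def by blast
  obtain L where L: "L \<ge> 0" "\<And>t \<xi> \<omega> \<mu>. t \<ge> 0 \<Longrightarrow> norm \<xi> \<le> r \<Longrightarrow> norm \<omega> \<le> r \<Longrightarrow> norm \<mu> \<le> r \<Longrightarrow>
      norm (f t \<xi> \<mu> - f t \<omega> \<mu>) \<le> L * norm (\<xi> - \<omega>)"
    using SL2 \<open>r > 0\<close> by meson
  define C where "C = exp (M * L * T0)"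
  have C: "C > 0" by (simp add: C_def)
  \<comment> \<open>\<open>e\<close> and \<open>\<delta>\<close> are chosen so that each contributes \<open>\<epsilon> / (2 * C)\<close> before the Gronwall factor \<open>C\<close>.\<close>
  define e where "e = \<epsilon> / (2 * M * T0 * C)"
  have e: "e > 0" using \<open>\<epsilon> > 0\<close> \<open>T0 > 0\<close> M(1) C by (simp add: e_def)
  obtain K where K: "K > 0" "\<And>t \<xi> \<mu>. t \<ge> 0 \<Longrightarrow> norm \<xi> \<le> r \<Longrightarrow>
       norm (f t \<xi> \<mu> - f t \<xi> 0) \<le> e + K * \<gamma> (norm \<mu>)"
    using input_perturbation_bound[OF gamma N SL3 SL4 \<open>r > 0\<close> e] by blast
  define \<delta> where "\<delta> = \<epsilon> / (2 * M * K * C)"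
  have \<delta>: "\<delta> > 0" using \<open>\<epsilon> > 0\<close> K(1) M(1) C by (simp add: \<delta>_def)
  have budget: "M * (e * T0 + K * \<delta>) = \<epsilon> / C"
    using M(1) K(1) C \<open>T0 > 0\<close> by (simp add: e_def \<delta>_def field_simps)
  show "\<exists>\<delta>>0. \<forall>t0\<ge>0. \<forall>x0 u.
      admissible_input u \<longrightarrow> gamma_norm \<gamma> u \<le> ennreal \<delta> \<longrightarrow>
      (\<forall>\<tau>x x \<tau>z z.
         maximal_weak_solution T f t0 x0 u \<tau>x x \<longrightarrow>
         maximal_weak_solution T f t0 x0 (\<lambda>_. 0) \<tau>z z \<longrightarrow>
         (\<forall>t'\<in>{t0..t0 + T0}.
            ereal t' < \<tau>x \<longrightarrow> ereal t' < \<tau>z \<longrightarrow>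
            (\<forall>t\<in>{t0..t'}. norm (x t) \<le> r \<and> norm (z t) \<le> r) \<longrightarrow>
            (\<forall>t\<in>{t0..t'}. norm (z t - x t) \<le> \<epsilon>)))"
  proof (intro exI[of _ \<delta>] conjI allI impI ballI)
    fix t0 :: real and x0 u \<tau>x x \<tau>z z t' t
    assume "t0 \<ge> 0" and u: "admissible_input u" "gamma_norm \<gamma> u \<le> ennreal \<delta>"
      and "maximal_weak_solution T f t0 x0 u \<tau>x x"
      and "maximal_weak_solution T f t0 x0 (\<lambda>_. 0) \<tau>z z"
      and t': "t' \<in> {t0..t0 + T0}" "ereal t' < \<tau>x" "ereal t' < \<tau>z"
      and bd: "\<forall>t\<in>{t0..t'}. norm (x t) \<le> r \<and> norm (z t) \<le> r"
      and t: "t \<in> {t0..t'}"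
    then have x: "weak_solution T f t0 x0 u {t. t0 \<le> t \<and> ereal t < \<tau>x} x"
      and z: "weak_solution T f t0 x0 (\<lambda>_. 0) {t. t0 \<le> t \<and> ereal t < \<tau>z} z"
      by (auto simp: maximal_weak_solution_def)
    have sub: "{t0..t'} \<subseteq> {t. t0 \<le> t \<and> ereal t < \<tau>x}" "{t0..t'} \<subseteq> {t. t0 \<le> t \<and> ereal t < \<tau>z}"
      using t' by (auto intro: le_less_trans[of _ "ereal t'"])
    define \<phi> where "\<phi> s = norm (x s - z s)" for s
    have cont: "continuous_on {t0..t'} \<phi>"
      using x z sub unfolding weak_solution_def \<phi>_def
      by (intro continuous_intros) (auto intro: continuous_on_subset)
    have ineq: "\<phi> s \<le> \<epsilon> / C + (M * L) * integral {t0..s} \<phi>" if s: "s \<in> {t0..t'}" for s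
    proof -
      have contsub: "continuous_on {t0..s} \<phi>"
        using cont by (rule continuous_on_subset) (use s in auto)
      have "norm (x s - z s) \<le> M * (integral {t0..s} (\<lambda>\<sigma>. L * \<phi> \<sigma> + e) + K * \<delta>)"
      proof (rule weak_solution_difference_bound[OF x _ z, where k = "\<lambda>\<sigma>. K * \<gamma> (norm (u \<sigma>))"])
        show "{t0..s} \<subseteq> {t. t0 \<le> t \<and> ereal t < \<tau>x}" "{t0..s} \<subseteq> {t. t0 \<le> t \<and> ereal t < \<tau>z}"
          using sub s by fastforce+
        show "t0 \<le> s" using s by simp
        show "norm (T \<sigma>) \<le> M" if "\<sigma> \<in> {0..s - t0}" for \<sigma>
          using that s t' by (intro M) auto
        show "continuous_on {t0..s} (\<lambda>\<sigma>. L * \<phi> \<sigma> + e)"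
          by (intro continuous_intros contsub)
        show "0 \<le> L * \<phi> \<sigma> + e" for \<sigma> using L(1) e by (simp add: \<phi>_def)
        show "0 \<le> K * \<gamma> (norm (u \<sigma>))" for \<sigma>
          using K(1) class_K_infinity_nonneg[OF gamma] by simp
        show "(\<lambda>\<sigma>. indicator {t0..s} \<sigma> * (K * \<gamma> (norm (u \<sigma>)))) \<in> borel_measurable borel"
          using borel_measurable_times[OF borel_measurable_const[of K]
              admissible_input_measurable[OF u(1) gamma \<open>t0 \<ge> 0\<close>, of s]]
          by (simp add: mult.left_commute)
        show "0 \<le> K * \<delta>" using K(1) \<delta> by simp
        show "norm (f \<sigma> (x \<sigma>) (u \<sigma>) - f \<sigma> (z \<sigma>) 0) \<le> (L * \<phi> \<sigma> + e) + K * \<gamma> (norm (u \<sigma>))"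
          if \<sigma>: "\<sigma> \<in> {t0..s}" for \<sigma>
        proof -
          have \<sigma>0: "\<sigma> \<ge> 0" and b: "norm (x \<sigma>) \<le> r" "norm (z \<sigma>) \<le> r"
            using \<sigma> s \<open>t0 \<ge> 0\<close> bd by auto
          have "norm (f \<sigma> (x \<sigma>) (u \<sigma>) - f \<sigma> (z \<sigma>) 0)
              \<le> norm (f \<sigma> (x \<sigma>) (u \<sigma>) - f \<sigma> (x \<sigma>) 0) + norm (f \<sigma> (x \<sigma>) 0 - f \<sigma> (z \<sigma>) 0)"
            using norm_triangle_ineq[of "f \<sigma> (x \<sigma>) (u \<sigma>) - f \<sigma> (x \<sigma>) 0" "f \<sigma> (x \<sigma>) 0 - f \<sigma> (z \<sigma>) 0"]
            by simp
          also have "\<dots> \<le> (e + K * \<gamma> (norm (u \<sigma>))) + L * norm (x \<sigma> - z \<sigma>)"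
            using \<open>r > 0\<close> by (intro add_mono K(2) L(2) \<sigma>0 b) simp
          finally show ?thesis by (simp add: \<phi>_def)
        qed
        have "(\<integral>\<^sup>+\<sigma>\<in>{t0..s}. ennreal (K * \<gamma> (norm (u \<sigma>))) \<partial>lborel)
            = (\<integral>\<^sup>+\<sigma>. ennreal K * ennreal (indicator {t0..s} \<sigma> * \<gamma> (norm (u \<sigma>))) \<partial>lborel)"
          using K(1) class_K_infinity_nonneg[OF gamma]
          by (intro nn_integral_cong) (auto simp: indicator_def ennreal_mult)
        also have "\<dots> = ennreal K * (\<integral>\<^sup>+\<sigma>. ennreal (indicator {t0..s} \<sigma> * \<gamma> (norm (u \<sigma>))) \<partial>lborel)"
          using admissible_input_measurable[OF u(1) gamma \<open>t0 \<ge> 0\<close>, of s]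
          by (intro nn_integral_cmult) simp
        also have "\<dots> \<le> ennreal K * gamma_norm \<gamma> u"
          unfolding gamma_norm_def using \<open>t0 \<ge> 0\<close>
          by (intro mult_left_mono nn_integral_mono) (auto simp: indicator_def)
        also have "\<dots> \<le> ennreal K * ennreal \<delta>"
          using u(2) by (intro mult_left_mono) auto
        also have "\<dots> = ennreal (K * \<delta>)"
          using K(1) \<delta> by (simp add: ennreal_mult)
        finally show "(\<integral>\<^sup>+\<sigma>\<in>{t0..s}. ennreal (K * \<gamma> (norm (u \<sigma>))) \<partial>lborel) \<le> ennreal (K * \<delta>)" .
      qed
      also have "integral {t0..s} (\<lambda>\<sigma>. L * \<phi> \<sigma> + e) = L * integral {t0..s} \<phi> + e * (s - t0)"
        using s integrable_continuous_interval[OF contsub]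
        by (subst integral_add) (auto intro!: integrable_on_mult_right)
      also have "\<dots> \<le> L * integral {t0..s} \<phi> + e * T0"
        using s t' e by simp
      finally have "\<phi> s \<le> M * (L * integral {t0..s} \<phi> + e * T0 + K * \<delta>)"
        using M(1) by (simp add: \<phi>_def)
      also have "\<dots> = M * (e * T0 + K * \<delta>) + (M * L) * integral {t0..s} \<phi>"
        by (simp add: algebra_simps)
      finally show ?thesis by (simp add: budget)
    qed
    have "\<phi> t \<le> \<epsilon> / C * exp (M * L * (t - t0))"
      using cont _ ineq t by (rule gronwall) (use M(1) L(1) in simp)
    also have "\<dots> \<le> \<epsilon> / C * C"
      unfolding C_def using t t' M(1) L(1) \<open>\<epsilon> > 0\<close>
      by (intro mult_left_mono) (auto intro!: mult_left_mono)
    also have "\<dots> = \<epsilon>" using C by simp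
    finally show "norm (z t - x t) \<le> \<epsilon>" by (simp add: \<phi>_def norm_minus_commute)
  qed (rule \<delta>)
qed

end
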